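(* Let $d \ge 1$ be an integer and let $X \subset \mathbb{R}^d$ be a nonempty compact set (not necessarily convex or connected). Then there exist $d+1$ points $v_1,\dots,v_{d+1} \in X$ such that, writing $T$ for the simplex with vertices $v_1,\dots,v_{d+1}$, the set $X$ is contained in a translate of $(d+2)T$; that is, there exists $z \in \mathbb{R}^d$ with $X \subset z + (d+2)T$.
   Context: Given $d+1$ points $v_1,\dots,v_{d+1}$ in $\mathbb{R}^d$, the simplex with vertices $v_1,\dots,v_{d+1}$ is their convex hull; the points are not required to be distinct or affinely independent. For $\lambda \in \mathbb{R}$ and $T \subset \mathbb{R}^d$, $\lambda T = \{\lambda x : x \in T\}$, and a translate of a set $S \subset \mathbb{R}^d$ is a set $z + S = \{z+s : s\in S\}$ with $z \in \mathbb{R}^d$. *)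

theory Defs imports "HOL-Analysis.Analysis" begin

end

theory Submission imports Defs begin

text \<open>
  Lift \<open>X\<close> to height one in \<open>\<real>\<^sup>d\<^sup>+\<^sup>1\<close> and choose points of the lifted set that span it and
  have maximal determinant, after completing them by fixed vectors to a basis when \<open>X\<close> lies in a
  proper affine subspace. By Cramer's rule, every lifted point is a combination of the chosen ones
  with coefficients \<open>c\<^sub>i\<close> in \<open>[-1, 1]\<close>, and these sum to one because of the last coordinate.
  Hence \<open>\<mu>\<^sub>i = (c\<^sub>i + 1) / (d + 2)\<close> are convex weights and
  \<open>x = (d + 2) (\<Sum>\<^sub>i \<mu>\<^sub>i v\<^sub>i) - \<Sum>\<^sub>i v\<^sub>i\<close>.
\<close>

text \<open>Cramer's rule in row form: expanding along row \<open>k\<close> by multilinearity, every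
  term with \<open>j\<close> different from \<open>k\<close> repeats a row and vanishes.\<close>

lemma det_replace_row_by_combination:
  fixes A :: "real ^ 'n ^ 'n"
  shows "det (\<chi> i. if i = k then (\<Sum>j\<in>UNIV. c j *\<^sub>R A $ j) else A $ i) = c k * det A"
proof -
  have "row i A = A $ i" for i
    by (simp add: row_def vec_eq_iff)
  then show ?thesis
    using cramer_lemma_transpose[where x = "\<chi> j. c j" and A = A and k = k]
    by (simp add: scalar_mult_eq_scaleR cong: if_cong)
qed

text \<open>\<open>independent\<close> sees only the set of rows and would miss a repeated row;
  injectivity of \<open>($) A\<close> records that the rows are distinct.\<close>

lemma det_rows_independent:
  fixes A :: "real ^ 'n ^ 'n"
  assumes "det A \<noteq> 0"
  shows "inj (($) A)" and "independent (range (($) A))"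
proof -
  have row: "\<And>i. row i A = A $ i"
    by (simp add: row_def vec_eq_iff)
  show "inj (($) A)"
    using det_identical_rows[of _ _ A] assms row by (metis injI)
  have "rows A = range (($) A)"
    by (auto simp: rows_def row)
  moreover have "vec.independent (rows A)"
    using det_dependent_rows[of A] assms by blast
  ultimately show "independent (range (($) A))"
    by (simp add: dependent_vec_eq)
qed

text \<open>A nonzero kernel vector of the transpose would be the coefficient vector of a linear
  dependence among the rows.\<close>

lemma det_nonzero_if_rows_independent:
  fixes A :: "real ^ 'n ^ 'n"
  assumes "inj (($) A)" and "independent (range (($) A))"
  shows "det A \<noteq> 0"
proof
  assume "det A = 0"
  then have "\<not> invertible (transpose A)"
    by (simp add: invertible_det_nz)
  then obtain x where x: "transpose A *v x = 0" "x \<noteq> 0"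
    using invertible_left_inverse matrix_left_invertible_ker by blast
  have "(\<Sum>i\<in>UNIV. x $ i *\<^sub>R A $ i) = 0"
    using x(1) by (simp add: matrix_mult_sum column_transpose row_def scalar_mult_eq_scaleR)
  then have "x $ i = 0" for i
    using independentD[OF assms(2), of "range (($) A)" "\<lambda>y. x $ inv (($) A) y" "A $ i"] assms(1)
    by (simp add: sum.reindex)
  with x(2) show False
    by (simp add: vec_eq_iff)
qed

lemma continuous_on_det: "continuous_on S (det :: real ^ 'n ^ 'n \<Rightarrow> real)"
  unfolding det_def by (intro continuous_intros)

lemma compact_vector_box:
  fixes S :: "'n::finite \<Rightarrow> 'a::euclidean_space set"
  assumes "\<And>i. compact (S i)"
  shows "compact {x. \<forall>i. x $ i \<in> S i}"
proof -
  have "\<forall>i. \<exists>b. \<forall>y\<in>S i. norm y \<le> b"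
    using assms by (meson bounded_iff compact_imp_bounded)
  then obtain b where b: "\<And>i y. y \<in> S i \<Longrightarrow> norm y \<le> b i"
    by metis
  have "norm x \<le> (\<Sum>i\<in>UNIV. b i)" if "\<forall>i. x $ i \<in> S i" for x
  proof -
    have "norm x \<le> (\<Sum>i\<in>UNIV. norm (x $ i))"
      unfolding norm_vec_def by (simp add: L2_set_le_sum)
    also have "\<dots> \<le> (\<Sum>i\<in>UNIV. b i)"
      using that b by (intro sum_mono) auto
    finally show ?thesis .
  qed
  then have "bounded {x. \<forall>i. x $ i \<in> S i}"
    by (auto intro!: boundedI)
  moreover have "closed {x. \<forall>i. x $ i \<in> S i}"
    using assms by (intro closed_vector_box) (auto intro: compact_imp_closed)
  ultimately show ?thesis
    by (simp add: compact_eq_bounded_closed)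
qed

text \<open>An Auerbach-type lemma that also covers \<open>Y\<close> spanning a proper subspace; the
  family is still indexed by all of \<open>'n\<close>.\<close>

lemma compact_spanned_by_bounded_coefficients:
  fixes Y :: "(real ^ 'n) set"
  assumes "compact Y" and "Y \<noteq> {}"
  obtains v :: "'n \<Rightarrow> real ^ 'n"
  where "\<And>i. v i \<in> Y"
    and "\<And>y. y \<in> Y \<Longrightarrow> \<exists>c. y = (\<Sum>i\<in>UNIV. c i *\<^sub>R v i) \<and> (\<forall>i. \<bar>c i\<bar> \<le> 1)"
proof -
  obtain B where B: "B \<subseteq> Y" "independent B" "Y \<subseteq> span B" "card B = dim Y"
    using basis_exists by blast
  define E where "E = extend_basis B"
  have E: "B \<subseteq> E" "independent E" "span E = UNIV"
    unfolding E_def using extend_basis_superset independent_extend_basis span_extend_basis B(2)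
    by blast+
  have "card E = CARD('n)"
    using dim_eq_card[of E UNIV] E by simp
  then obtain f :: "'n \<Rightarrow> real ^ 'n" where f: "bij_betw f UNIV E"
    using finite_same_card_bij[of "UNIV :: 'n set" E] independent_imp_finite[OF E(2)] by auto
  \<comment> \<open>Rows in \<open>J\<close> range over \<open>Y\<close>. The others stay frozen at
    basis vectors outside \<open>B\<close>, which keeps the matrices square.\<close>
  define J where "J = f -` B"
  have fJ: "f ` J = B"
    unfolding J_def using f E(1) by (auto simp: bij_betw_def)
  have cardJ: "card J = dim Y"
    using card_image[of f J] f fJ B(4) by (metis bij_betw_def inj_on_subset subset_UNIV)
  define R where "R i = (if i \<in> J then Y else {f i})" for i
  define K :: "(real ^ 'n ^ 'n) set" where "K = {A. \<forall>i. A $ i \<in> R i}"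
  have K_row: "A $ i \<in> Y" if "A \<in> K" "i \<in> J" for A i
    using that unfolding K_def R_def by (metis (mono_tags, lifting) mem_Collect_eq)
  have "compact K"
    unfolding K_def by (rule compact_vector_box) (simp add: R_def assms(1))
  \<comment> \<open>The basis itself is a competitor: it makes \<open>K\<close> nonempty and the
    maximum of \<open>\<bar>det M\<bar>\<close> positive.\<close>
  have fK: "(\<chi> i. f i) \<in> K"
    unfolding K_def R_def using B(1) by (auto simp: J_def)
  have "det (\<chi> i. f i) \<noteq> 0"
    using f E(2) by (intro det_nonzero_if_rows_independent) (auto simp: bij_betw_def inj_def)
  have "continuous_on K (\<lambda>M. \<bar>det M\<bar>)"
    by (intro continuous_on_rabs continuous_on_det)
  then obtain A where A: "A \<in> K" "\<And>M. M \<in> K \<Longrightarrow> \<bar>det M\<bar> \<le> \<bar>det A\<bar>"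
    using continuous_attains_sup[OF \<open>compact K\<close>] fK by blast
  have detA: "det A \<noteq> 0"
    using A(2)[OF fK] \<open>det (\<chi> i. f i) \<noteq> 0\<close> by auto
  note indep = det_rows_independent[OF detA]
  \<comment> \<open>The rows in \<open>J\<close> are \<open>dim Y\<close> many independent vectors
    of \<open>Y\<close>. So each point of \<open>Y\<close> is a combination of them alone, and
    frozen rows, which \<open>y\<close> could not replace within \<open>K\<close>, get coefficient
    zero.\<close>
  have "Y \<subseteq> span ((($) A) ` J)"
  proof (rule card_ge_dim_independent)
    show "independent ((($) A) ` J)"
      using indep(2) by (rule independent_mono) auto
    show "dim Y \<le> card ((($) A) ` J)"
      using card_image[of "($) A" J] indep(1) cardJ by (metis inj_on_subset order_refl subset_UNIV)
  qed (use K_row[OF A(1)] in auto)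
  obtain y0 where "y0 \<in> Y" using assms(2) by auto
  show thesis
  \<comment> \<open>Frozen rows need not lie in \<open>Y\<close>. Their coefficient is zero, so any
    point \<open>y0\<close> of \<open>Y\<close> can stand in for them.\<close>
  proof (rule that[of "\<lambda>i. if i \<in> J then A $ i else y0"])
    show "(if i \<in> J then A $ i else y0) \<in> Y" for i
      using K_row[OF A(1)] \<open>y0 \<in> Y\<close> by simp
    fix y assume "y \<in> Y"
    then have "y \<in> span ((($) A) ` J)"
      using \<open>Y \<subseteq> span ((($) A) ` J)\<close> by auto
    then obtain u where "y = (\<Sum>w\<in>(($) A) ` J. u w *\<^sub>R w)"
      by (auto simp: span_finite)
    then have yJ: "y = (\<Sum>i\<in>J. u (A $ i) *\<^sub>R A $ i)"
      using indep(1) by (simp add: sum.reindex inj_on_subset)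
    define c where "c i = (if i \<in> J then u (A $ i) else 0)" for i
    have y: "y = (\<Sum>i\<in>UNIV. c i *\<^sub>R A $ i)"
      unfolding yJ c_def by (rule sum.mono_neutral_cong_left) auto
    have "\<bar>c k\<bar> \<le> 1" for k
    proof (cases "k \<in> J")
      case True
      \<comment> \<open>Putting \<open>y\<close> into a free row of the maximiser stays in
        \<open>K\<close> and multiplies the determinant by \<open>c k\<close>.\<close>
      have "(\<chi> i. if i = k then y else A $ i) \<in> K"
        using A(1) \<open>y \<in> Y\<close> True by (simp add: K_def R_def[of k])
      from A(2)[OF this] have "\<bar>c k * det A\<bar> \<le> \<bar>det A\<bar>"
        unfolding y det_replace_row_by_combination .
      then show ?thesis
        using detA by (simp add: abs_mult)
    qed (simp add: c_def)
    moreover have "y = (\<Sum>i\<in>UNIV. c i *\<^sub>R (if i \<in> J then A $ i else y0))"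
      unfolding y by (rule sum.cong) (auto simp: c_def)
    ultimately show "\<exists>c. y = (\<Sum>i\<in>UNIV. c i *\<^sub>R (if i \<in> J then A $ i else y0)) \<and> (\<forall>i. \<bar>c i\<bar> \<le> 1)"
      by blast
  qed
qed

text \<open>\<open>'d option\<close> has exactly one index more than \<open>'d\<close>; the constant
  coordinate \<open>None\<close> turns linear combinations of lifted points into affine
  ones.\<close>

definition lift_to_height_one :: "real ^ 'd \<Rightarrow> real ^ ('d option)" where
  "lift_to_height_one x = (\<chi> i. case i of None \<Rightarrow> 1 | Some j \<Rightarrow> x $ j)"

lemma lift_to_height_one_nth [simp]:
  "lift_to_height_one x $ None = 1" "lift_to_height_one x $ Some j = x $ j"
  by (simp_all add: lift_to_height_one_def)

lemma continuous_on_lift_to_height_one: "continuous_on S lift_to_height_one"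
  unfolding lift_to_height_one_def
proof (rule continuous_on_vec_lambda)
  show "continuous_on S (\<lambda>x. case i of None \<Rightarrow> 1 | Some j \<Rightarrow> x $ j)" for i
    by (cases i) (auto intro: continuous_intros)
qed

lemma compact_bounded_barycentric_coordinates:
  fixes X :: "(real ^ 'd) set"
  assumes "compact X" and "X \<noteq> {}"
  obtains w :: "'d option \<Rightarrow> real ^ 'd"
  where "\<And>i. w i \<in> X"
    and "\<And>x. x \<in> X \<Longrightarrow> \<exists>c. x = (\<Sum>i\<in>UNIV. c i *\<^sub>R w i) \<and> sum c UNIV = 1 \<and> (\<forall>i. \<bar>c i\<bar> \<le> 1)"
proof -
  have "compact (lift_to_height_one ` X)"
    by (intro compact_continuous_image continuous_on_lift_to_height_one assms)
  then obtain y :: "'d option \<Rightarrow> real ^ ('d option)" where y: "\<And>i. y i \<in> lift_to_height_one ` X"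
    "\<And>u. u \<in> lift_to_height_one ` X \<Longrightarrow>
        \<exists>c. u = (\<Sum>i\<in>UNIV. c i *\<^sub>R y i) \<and> (\<forall>i. \<bar>c i\<bar> \<le> 1)"
    using compact_spanned_by_bounded_coefficients[of "lift_to_height_one ` X"] assms(2) by blast
  have "\<forall>i. \<exists>x. x \<in> X \<and> y i = lift_to_height_one x"
    using y(1) by blast
  then obtain w where w: "\<And>i. w i \<in> X" "\<And>i. y i = lift_to_height_one (w i)"
    by metis
  show thesis
  proof (rule that[of w])
    fix x assume "x \<in> X"
    then obtain c where c: "lift_to_height_one x = (\<Sum>i\<in>UNIV. c i *\<^sub>R y i)" "\<forall>i. \<bar>c i\<bar> \<le> 1"
      using y(2) by blast
    \<comment> \<open>The coordinate \<open>None\<close> of the lifted identity is the sum of the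
      coefficients; the coordinates \<open>Some j\<close> give back \<open>x\<close>.\<close>
    have "sum c UNIV = 1"
      using arg_cong[OF c(1), of "\<lambda>u. u $ None"] by (simp add: w(2))
    moreover have "x $ j = (\<Sum>i\<in>UNIV. c i *\<^sub>R w i) $ j" for j
      using arg_cong[OF c(1), of "\<lambda>u. u $ Some j"] by (simp add: w(2))
    ultimately show "\<exists>c. x = (\<Sum>i\<in>UNIV. c i *\<^sub>R w i) \<and> sum c UNIV = 1 \<and> (\<forall>i. \<bar>c i\<bar> \<le> 1)"
      using c(2) by (auto simp: vec_eq_iff)
  qed (rule w(1))
qed

text \<open>Adding 1 to each coefficient makes it nonnegative and raises the total to
  \<open>CARD('i) + 1\<close>, the scaling factor; the translation by \<open>- sum w UNIV\<close>
  undoes the shift.\<close>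

lemma mem_scaled_simplex_if_coordinates_ge:
  fixes w :: "'i::finite \<Rightarrow> 'a::real_vector"
  assumes "sum c UNIV = 1" and "\<And>i. - 1 \<le> c i"
  shows "(\<Sum>i\<in>UNIV. c i *\<^sub>R w i) \<in>
    (\<lambda>s. - sum w UNIV + s) ` (\<lambda>x. real (CARD('i) + 1) *\<^sub>R x) ` (convex hull range w)"
proof -
  define n where "n = real (CARD('i) + 1)"
  have n: "n > 0" by (simp add: n_def)
  define p where "p = (\<Sum>i\<in>UNIV. ((c i + 1) / n) *\<^sub>R w i)"
  have "p \<in> convex hull range w"
    unfolding p_def
  proof (rule convex_sum)
    show "(\<Sum>i\<in>UNIV. (c i + 1) / n) = 1"
      using n assms(1) by (simp add: sum.distrib n_def flip: sum_divide_distrib)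
    show "0 \<le> (c i + 1) / n" for i
      using assms(2)[of i] n by simp
  qed (auto intro: hull_inc)
  moreover have "(\<Sum>i\<in>UNIV. c i *\<^sub>R w i) = - sum w UNIV + n *\<^sub>R p"
    using n by (simp add: p_def scaleR_sum_right scaleR_add_left sum.distrib)
  ultimately show ?thesis
    unfolding n_def by blast
qed

theorem theorem3p1:
  fixes X :: "(real ^ 'd) set"
  assumes "compact X" and "X \<noteq> {}"
  shows "\<exists>v :: nat \<Rightarrow> real ^ 'd.
           (\<forall>i \<in> {1..CARD('d) + 1}. v i \<in> X) \<and>
           (\<exists>z. X \<subseteq> (\<lambda>s. z + s) ` ((\<lambda>x. real (CARD('d) + 2) *\<^sub>R x) `
                       (convex hull (v ` {1..CARD('d) + 1}))))"
proof -
  obtain w :: "'d option \<Rightarrow> real ^ 'd" where w: "\<And>i. w i \<in> X"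
    "\<And>x. x \<in> X \<Longrightarrow> \<exists>c. x = (\<Sum>i\<in>UNIV. c i *\<^sub>R w i) \<and> sum c UNIV = 1 \<and> (\<forall>i. \<bar>c i\<bar> \<le> 1)"
    using compact_bounded_barycentric_coordinates[OF assms] by blast
  have card: "CARD('d option) = CARD('d) + 1"
    by simp
  \<comment> \<open>The vertices are renumbered from \<open>'d option\<close> to
    \<open>{1..CARD('d) + 1}\<close>; the convex hull depends only on their set.\<close>
  then obtain h :: "nat \<Rightarrow> 'd option" where "bij_betw h {1..CARD('d) + 1} UNIV"
    using finite_same_card_bij[of "{1..CARD('d) + 1}" "UNIV :: 'd option set"] by auto
  then have range: "(w \<circ> h) ` {1..CARD('d) + 1} = range w"
    by (metis bij_betw_def image_comp)
  have "X \<subseteq> (\<lambda>s. - sum w UNIV + s) ` (\<lambda>x. real (CARD('d) + 2) *\<^sub>R x) `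
              (convex hull ((w \<circ> h) ` {1..CARD('d) + 1}))"
  proof
    fix x assume "x \<in> X"
    then obtain c where c: "x = (\<Sum>i\<in>UNIV. c i *\<^sub>R w i)" "sum c UNIV = 1" "\<forall>i. \<bar>c i\<bar> \<le> 1"
      using w(2) by blast
    have "- 1 \<le> c i" for i
      using c(3)[rule_format, of i] by linarith
    then show "x \<in> (\<lambda>s. - sum w UNIV + s) ` (\<lambda>x. real (CARD('d) + 2) *\<^sub>R x) `
                      (convex hull ((w \<circ> h) ` {1..CARD('d) + 1}))"
      using mem_scaled_simplex_if_coordinates_ge[OF c(2), of w] unfolding range c(1) card by simp
  qed
  then show ?thesis
    using w(1) by (intro exI[of _ "w \<circ> h"] conjI exI[of _ "- sum w UNIV"]) auto
qed

end
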